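(* Suppose $\nabla f_t(x_t^* )=0$ for every $t\in\mathbb{Z}_{\ge0}$, and suppose there are $\mu>0$, $L>0$ and $L_1,\ldots,L_P>0$ such that for all $t\in\mathbb{Z}_{\ge0}$, $x,y\in\mathbb{R}^n$, $1\le i\le P$ and $u\in\mathbb{R}^{n_i}$, $$f_t(y)\ge f_t(x)+\nabla f_t(x)^T(y-x)+\frac{\mu}{2}|y-x|^2,\quad |\nabla f_t(x)-\nabla f_t(y)|\le L|x-y|,\quad |\nabla_{(i)}f_t(x+H_iu)-\nabla_{(i)}f_t(x)|\le L_i|u| .$$ Let $L_{\max}=\max\{L_1,\ldots,L_P\}$, and let the stepsize be a constant $\alpha_t=\alpha<\frac{2}{L_{\max}}$. Put $A=\dfrac{\alpha-\frac{\alpha^2L_{\max}}{2}}{2(1+\alpha^2L^2P)}$ and let $k\ge1$ be an integer such that $$B_5:=\frac{L}{\mu}(1-2\mu A)^{\frac{k+1-P}{P}}(1+\alpha L_{\max})^{2P-2}<\frac12 .$$ Then the dynamic regret of the $k$-step online cyclic coordinate descent algorithm satisfies $$R_T^d\le\frac{L}{2-4B_5}(2C_{T,2}+C_2),$$ where $C_{T,2}=\sum_{t=1}^T|x_t^*-x_{t-1}^*|^2$ and $C_2=|x_1-x_1^*|^2-2|x_1^*-x_0^*|^2$.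
   Context: For each $t\in\mathbb{Z}_{\ge0}$, $f_t:\mathbb{R}^n\to\mathbb{R}$ is convex and continuously differentiable; $\Theta\subseteq\mathbb{R}^n$ is a non-empty closed convex set with Euclidean projection $\Pi_\Theta$; $|\cdot|$ is the Euclidean norm. The decision variable is partitioned into $P$ blocks, $x=(x_{(1)},\ldots,x_{(P)})$, $x_{(p)}\in\mathbb{R}^{n_p}$, $\sum_{p=1}^P n_p=n$; $\nabla_{(p)}f_t$ denotes the $p$-th block of the gradient, and $H_i\in\mathbb{R}^{n\times n_i}$ are the matrices with $[H_1\ H_2\cdots H_P]=I_n$. $k$-step online cyclic coordinate descent algorithm: start from $x_0\in\Theta$, an initial block index, and an integer $k\ge1$. At each time $t$ set $\hat x_0=x_t$ and perform $k$ block updates with the function $f_t$: for $\kappa=1,\ldots,k$, the updating block is $i_\kappa=(i_{\kappa-1}\bmod P)+1$ (where $i_0$ is the last block index used at the previous time, or the initial block index at the first time), and $\hat x_{(i_\kappa),\kappa}=\hat x_{(i_\kappa),\kappa-1}-\alpha_t\nabla_{(i_\kappa)}f_t(\hat x_{\kappa-1})$, $\hat x_{(i),\kappa}=\hat x_{(i),\kappa-1}$ for $i\ne i_\kappa$. Then $x_{t+1}=\Pi_\Theta(\hat x_k)$. Stepsizes are positive. $x_t^*\in\Theta$ denotes the minimizer of $f_t$ over $\Theta$. The dynamic regret (the algorithm being deterministic) is $R_T^d=\sum_{t=1}^Tf_t(x_t)-\sum_{t=1}^Tf_t(x_t^* )$. *)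

theory Defs
  imports "HOL-Analysis.Analysis"
begin

text \<open>
  A partition of the decision variable into \<open>P\<close> blocks is given by a map \<open>blk\<close> that sends every
  coordinate to the number of its block in \<open>{1..P}\<close>; so \<open>n\<^sub>p\<close> is the number of coordinates \<open>j\<close> with
  \<open>blk j = p\<close>, and these numbers add up to the dimension.
\<close>

definition block_partition :: "nat \<Rightarrow> ('n::finite \<Rightarrow> nat) \<Rightarrow> bool" where
  "block_partition P blk \<longleftrightarrow> (\<forall>j. blk j \<in> {1..P})"

text \<open>
  The block \<open>v_(i)\<close> is represented, isometrically, by \<open>H\<^sub>i v_(i)\<close> in the full space, where the
  columns of \<open>H\<^sub>i\<close> are the unit vectors of the coordinates in block \<open>i\<close>.  As \<open>v\<close> varies,
  \<open>block_part blk i v\<close> runs through all \<open>H\<^sub>i u\<close> with \<open>u\<close> of dimension \<open>n\<^sub>i\<close>, and its norm is that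
  of \<open>u\<close>.
\<close>

definition block_part :: "('n::finite \<Rightarrow> nat) \<Rightarrow> nat \<Rightarrow> real ^ 'n \<Rightarrow> real ^ 'n" where
  "block_part blk i v = (\<chi> j. if blk j = i then v $ j else 0)"

text \<open>A state consists of the current point and the index of the block updated last.\<close>

definition block_update ::
  "nat \<Rightarrow> ('n::finite \<Rightarrow> nat) \<Rightarrow> real \<Rightarrow> (real ^ 'n \<Rightarrow> real ^ 'n) \<Rightarrow> (real ^ 'n) \<times> nat \<Rightarrow> (real ^ 'n) \<times> nat" where
  "block_update P blk a g s =
     (let y = fst s; i = snd s mod P + 1
      in (\<chi> j. if blk j = i then y $ j - a * g y $ j else y $ j, i))"

primrec cyclic_cd_state ::
  "nat \<Rightarrow> ('n::finite \<Rightarrow> nat) \<Rightarrow> (real ^ 'n) set \<Rightarrow> nat \<Rightarrow> (nat \<Rightarrow> real)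
    \<Rightarrow> (nat \<Rightarrow> real ^ 'n \<Rightarrow> real ^ 'n) \<Rightarrow> real ^ 'n \<Rightarrow> nat \<Rightarrow> nat \<Rightarrow> (real ^ 'n) \<times> nat" where
  "cyclic_cd_state P blk \<Theta> k \<alpha> g x0 i0 0 = (x0, i0)"
| "cyclic_cd_state P blk \<Theta> k \<alpha> g x0 i0 (Suc t) =
     (let s = (block_update P blk (\<alpha> t) (g t) ^^ k) (cyclic_cd_state P blk \<Theta> k \<alpha> g x0 i0 t)
      in (closest_point \<Theta> (fst s), snd s))"

definition cyclic_cd ::
  "nat \<Rightarrow> ('n::finite \<Rightarrow> nat) \<Rightarrow> (real ^ 'n) set \<Rightarrow> nat \<Rightarrow> (nat \<Rightarrow> real)
    \<Rightarrow> (nat \<Rightarrow> real ^ 'n \<Rightarrow> real ^ 'n) \<Rightarrow> real ^ 'n \<Rightarrow> nat \<Rightarrow> nat \<Rightarrow> real ^ 'n" where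
  "cyclic_cd P blk \<Theta> k \<alpha> g x0 i0 t = fst (cyclic_cd_state P blk \<Theta> k \<alpha> g x0 i0 t)"

definition dynamic_regret ::
  "(nat \<Rightarrow> 'a \<Rightarrow> real) \<Rightarrow> (nat \<Rightarrow> 'a) \<Rightarrow> (nat \<Rightarrow> 'a) \<Rightarrow> nat \<Rightarrow> real" where
  "dynamic_regret f x xstar T = (\<Sum>t = 1..T. f t (x t)) - (\<Sum>t = 1..T. f t (xstar t))"

definition squared_path_length :: "(nat \<Rightarrow> 'a::real_normed_vector) \<Rightarrow> nat \<Rightarrow> real" where
  "squared_path_length xstar T = (\<Sum>t = 1..T. (norm (xstar t - xstar (t - 1)))\<^sup>2)"

end

theory Submission
  imports Defs
begin

text \<open>
  Everything rests on one contraction: \<open>k\<close> block updates with \<open>f t\<close> shrink the squared distance to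
  the minimizer \<open>xstar t\<close> by the factor \<open>B5\<close>, and the projection does not increase this distance
  because \<open>xstar t\<close> lies in \<open>\<Theta>\<close> (\<open>contraction\<close>).

  The contraction is first seen on function values.  One block update decreases the function by a
  multiple of the squared norm of the block of the gradient that it uses, by the descent inequality
  for functions with Lipschitz gradient (\<open>block_step_decrease\<close>).  In \<open>P\<close> consecutive updates each
  block is used exactly once.  The blocks are evaluated at different points, but the drift between
  these points is controlled by the very quantities that measure the decrease, so that their sum
  dominates, up to the factor \<open>2 (1 + \<alpha>\<^sup>2 L\<^sup>2 P)\<close>, the squared norm of the gradient at the start of the cycle
  (\<open>gradient_le_cycle_gradients\<close>).  Since strong convexity bounds the gap of the
  function value by the squared gradient norm (\<open>gap_le_gradient\<close>), a full cycle multiplies the gap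
  by at most \<open>1 - 2 \<mu> A\<close> (\<open>cycle_decrease\<close>).  There are \<open>k div P \<ge> (k + 1 - P) / P\<close> full cycles, and
  the updates outside of them do not increase the function.  The gap
  lies between \<open>\<mu> / 2\<close> and \<open>L / 2\<close> times the squared distance, whence the factor \<open>L / \<mu>\<close>; this uses that
  the gradient vanishes at \<open>xstar t\<close>.  Multiplication by
  \<open>(1 + \<alpha> Lmax) ^ (2 P - 2) \<ge> 1\<close> turns the resulting factor into \<open>B5\<close>.

  With \<open>|u + v|\<^sup>2 \<le> 2 |u|\<^sup>2 + 2 |v|\<^sup>2\<close> the contraction becomes a linear recursion for the squared
  tracking error with the factor \<open>2 B5 < 1\<close>, driven by the squared steps of the minimizers
  (\<open>tracking_error_sum\<close>), and the regret is at most \<open>L / 2\<close> times the sum of these errors.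
\<close>

section \<open>Blocks of coordinates\<close>

lemma block_part_diff: "block_part blk i (v - w) = block_part blk i v - block_part blk i w"
  by (simp add: block_part_def vec_eq_iff)

lemma block_part_scaleR: "block_part blk i (c *\<^sub>R v) = c *\<^sub>R block_part blk i v"
  by (simp add: block_part_def vec_eq_iff)

lemma block_part_disjoint: "i \<noteq> j \<Longrightarrow> block_part blk i (block_part blk j v) = 0"
  by (simp add: block_part_def vec_eq_iff)

lemma inner_block_part: "v \<bullet> block_part blk i w = block_part blk i v \<bullet> block_part blk i w"
  by (simp add: inner_vec_def block_part_def if_distrib if_distribR cong: if_cong)

lemma inner_block_part_self: "v \<bullet> block_part blk i v = (norm (block_part blk i v))\<^sup>2"
  by (subst inner_block_part) (rule dot_square_norm)

lemma norm_block_part_le: "norm (block_part blk i v) \<le> norm v"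
  by (rule norm_le_componentwise_cart) (simp add: block_part_def)

lemma norm_sq_eq_sum_blocks:
  assumes "block_partition P blk"
  shows "(norm v)\<^sup>2 = (\<Sum>i\<in>{1..P}. (norm (block_part blk i v))\<^sup>2)"
proof -
  have "(\<Sum>i\<in>{1..P}. block_part blk i v) = v"
    using assms by (simp add: vec_eq_iff block_part_def block_partition_def)
  then have "v \<bullet> v = v \<bullet> (\<Sum>i\<in>{1..P}. block_part blk i v)"
    by simp
  also have "\<dots> = (\<Sum>i\<in>{1..P}. (norm (block_part blk i v))\<^sup>2)"
    by (simp only: inner_sum_right inner_block_part_self)
  finally show ?thesis
    by (simp add: dot_square_norm)
qed

lemma block_partition_pos: "block_partition P blk \<Longrightarrow> 0 < P"
  by (auto simp: block_partition_def)

section \<open>Smooth and strongly convex functions\<close>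

text \<open>
  The difference between \<open>f\<close> and the quadratic upper model is nonincreasing along the
  segment from \<open>y\<close> to \<open>y + d\<close>.  Only the increments of the gradient in the direction \<open>d\<close>
  are bounded, so that the same inequality serves the full and the blockwise Lipschitz condition.
\<close>

lemma descent_inequality:
  fixes f :: "'a::real_inner \<Rightarrow> real"
  assumes grad: "\<And>y. GDERIV f y :> g y"
    and incr: "\<And>s. 0 \<le> s \<Longrightarrow> (g (y + s *\<^sub>R d) - g y) \<bullet> d \<le> M * s * (norm d)\<^sup>2"
  shows "f (y + d) \<le> f y + g y \<bullet> d + M / 2 * (norm d)\<^sup>2"
proof -
  define \<phi> where "\<phi> s = f (y + s *\<^sub>R d) - s * (g y \<bullet> d) - M / 2 * s\<^sup>2 * (norm d)\<^sup>2" for s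
  have line: "((\<lambda>s. f (y + s *\<^sub>R d)) has_real_derivative g (y + s *\<^sub>R d) \<bullet> d) (at s)" for s
  proof -
    have inner_deriv: "((\<lambda>s. y + s *\<^sub>R d) has_derivative (\<lambda>h. h *\<^sub>R d)) (at s)"
      by (auto intro!: derivative_eq_intros)
    have "(f has_derivative (\<lambda>h. h \<bullet> g (y + s *\<^sub>R d))) (at (y + s *\<^sub>R d))"
      using grad unfolding gderiv_def .
    from has_derivative_compose[OF inner_deriv this] show ?thesis
      by (simp add: has_field_derivative_def inner_commute mult.commute[of _ "d \<bullet> _"])
  qed
  have "(\<phi> has_real_derivative ((g (y + s *\<^sub>R d) - g y) \<bullet> d - M * s * (norm d)\<^sup>2)) (at s)" for s
  proof -
    have "((\<lambda>s. s * (g y \<bullet> d)) has_real_derivative g y \<bullet> d) (at s)"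
      and "((\<lambda>s. M / 2 * s\<^sup>2 * (norm d)\<^sup>2) has_real_derivative M * s * (norm d)\<^sup>2) (at s)"
      by (auto intro!: derivative_eq_intros)
    from DERIV_diff[OF DERIV_diff[OF line this(1)] this(2)] show ?thesis
      unfolding \<phi>_def inner_diff_left .
  qed
  then have "\<exists>D. (\<phi> has_real_derivative D) (at s) \<and> D \<le> 0" if "0 \<le> s" for s
    using incr[OF that] by (meson diff_le_0_iff_le)
  then have "\<phi> 1 \<le> \<phi> 0"
    by (intro DERIV_nonpos_imp_nonincreasing[of 0 1 \<phi>]) auto
  then show ?thesis
    by (simp add: \<phi>_def)
qed

text \<open>
  The quadratic lower bound at \<open>y\<close> is minimal where its gradient \<open>g y + \<mu> (z - y)\<close> vanishes;
  the Polyak-Lojasiewicz inequality compares with this minimal value.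
\<close>

lemma gap_le_gradient:
  fixes y z :: "'a::real_inner" and gy :: 'a
  assumes "\<mu> > 0" and lower: "fz \<ge> fy + gy \<bullet> (z - y) + \<mu> / 2 * (norm (z - y))\<^sup>2"
  shows "2 * \<mu> * (fy - fz) \<le> (norm gy)\<^sup>2"
proof -
  have "0 \<le> (norm (gy + \<mu> *\<^sub>R (z - y)))\<^sup>2"
    by simp
  also have "\<dots> = (norm gy)\<^sup>2 + 2 * \<mu> * (gy \<bullet> (z - y)) + \<mu>\<^sup>2 * (norm (z - y))\<^sup>2"
    unfolding power2_norm_eq_inner
    by (simp only: inner_add_left inner_add_right inner_scaleR_left inner_scaleR_right
        inner_commute[of "z - y" gy]) (simp add: power2_eq_square algebra_simps)
  finally have "0 \<le> (norm gy)\<^sup>2 + 2 * \<mu> * (gy \<bullet> (z - y)) + \<mu>\<^sup>2 * (norm (z - y))\<^sup>2" .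
  moreover have "2 * \<mu> * (fy + gy \<bullet> (z - y) + \<mu> / 2 * (norm (z - y))\<^sup>2) \<le> 2 * \<mu> * fz"
    using assms by (intro mult_left_mono) auto
  ultimately show ?thesis
    by (simp add: algebra_simps power2_eq_square)
qed

section \<open>Cyclic coordinate descent for one function\<close>

lemma block_update_eq:
  "block_update P blk a g s =
     (fst s - a *\<^sub>R block_part blk (snd s mod P + 1) (g (fst s)), snd s mod P + 1)"
  by (simp add: block_update_def block_part_def vec_eq_iff Let_def)

locale cyclic_descent =
  fixes f :: "real ^ 'n \<Rightarrow> real" and g :: "real ^ 'n \<Rightarrow> real ^ 'n"
    and blk :: "'n \<Rightarrow> nat" and P :: nat and \<mu> L M a :: real
  assumes grad: "\<And>y. GDERIV f y :> g y"
    and part: "block_partition P blk"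
    and mu_pos: "\<mu> > 0" and L_pos: "L > 0" and M_pos: "M > 0"
    and strongly_convex: "\<And>y z. f z \<ge> f y + g y \<bullet> (z - y) + \<mu> / 2 * (norm (z - y))\<^sup>2"
    and lipschitz: "\<And>y z. norm (g y - g z) \<le> L * norm (y - z)"
    and block_lipschitz: "\<And>y i u. i \<in> {1..P} \<Longrightarrow>
           norm (block_part blk i (g (y + block_part blk i u)) - block_part blk i (g y))
             \<le> M * norm (block_part blk i u)"
    and a_pos: "a > 0" and a_less: "a * M < 2"
begin

definition iter :: "(real ^ 'n) \<times> nat \<Rightarrow> nat \<Rightarrow> real ^ 'n" where
  "iter s m = fst ((block_update P blk a g ^^ m) s)"

definition active :: "(real ^ 'n) \<times> nat \<Rightarrow> nat \<Rightarrow> nat" where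
  "active s m = (snd s + m) mod P + 1"

definition used_gradients :: "(real ^ 'n) \<times> nat \<Rightarrow> nat \<Rightarrow> real" where
  "used_gradients s m = (\<Sum>l<m. (norm (block_part blk (active s l) (g (iter s l))))\<^sup>2)"

lemma used_gradients_nonneg: "0 \<le> used_gradients s m"
  by (simp add: used_gradients_def sum_nonneg)

lemma used_gradients_Suc:
  "used_gradients s (Suc m)
     = used_gradients s m + (norm (block_part blk (active s m) (g (iter s m))))\<^sup>2"
  by (simp add: used_gradients_def)

lemma used_gradients_mono: "m \<le> n \<Longrightarrow> used_gradients s m \<le> used_gradients s n"
  unfolding used_gradients_def by (rule sum_mono2) auto

lemma P_pos: "0 < P"
  using part by (rule block_partition_pos)

lemma iter_0: "iter s 0 = fst s"
  by (simp add: iter_def)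

lemma active_bij: "bij_betw (active s) {..<P} {1..P}"
proof -
  have inj: "inj_on (active s) {..<P}"
  proof (rule linorder_inj_onI')
    fix l m assume "l \<in> {..<P}" "m \<in> {..<P}" "l < m"
    then have "0 < m - l" "m - l < P"
      by auto
    then have "\<not> P dvd (snd s + m) - (snd s + l)"
      by (simp add: nat_dvd_not_less)
    then show "active s l \<noteq> active s m"
      using \<open>l < m\<close> mod_eq_dvd_iff_nat[of "snd s + l" "snd s + m" P]
      by (auto simp: active_def)
  qed
  moreover have "active s ` {..<P} \<subseteq> {1..P}"
    using P_pos by (auto simp: active_def Suc_le_eq)
  ultimately have "active s ` {..<P} = {1..P}"
    by (intro card_subset_eq) (auto simp: card_image)
  with inj show ?thesis
    by (simp add: bij_betw_def)
qed

lemma active_range: "active s m \<in> {1..P}"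
  using P_pos by (auto simp: active_def Suc_le_eq)

lemma iter_Suc:
  "iter s (Suc m) = iter s m - a *\<^sub>R block_part blk (active s m) (g (iter s m))"
proof -
  have "snd ((block_update P blk a g ^^ m) s) mod P = (snd s + m) mod P"
    by (induction m) (simp_all add: block_update_eq mod_Suc_eq)
  then show ?thesis
    by (simp add: iter_def active_def block_update_eq)
qed

lemma iter_add: "iter s (m + n) = iter ((block_update P blk a g ^^ n) s) m"
  by (simp add: iter_def funpow_add)

text \<open>
  A step of length \<open>a\<close> along minus a block of the gradient gains \<open>a\<close> to first order, and the
  curvature of \<open>f\<close> in the directions of this block costs at most \<open>a\<^sup>2 M / 2\<close>, both in units of the
  squared norm of the block of the gradient.
\<close>

lemma block_step_decrease:
  assumes "i \<in> {1..P}"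
  shows "f (y - a *\<^sub>R block_part blk i (g y))
           \<le> f y - (a - a\<^sup>2 * M / 2) * (norm (block_part blk i (g y)))\<^sup>2"
proof -
  define d where "d = block_part blk i (- a *\<^sub>R g y)"
  have d: "d = - a *\<^sub>R block_part blk i (g y)"
    by (simp only: d_def block_part_scaleR)
  have "f (y + d) \<le> f y + g y \<bullet> d + M / 2 * (norm d)\<^sup>2"
  proof (rule descent_inequality[OF grad])
    fix s :: real assume s: "0 \<le> s"
    have sd: "s *\<^sub>R d = block_part blk i (s *\<^sub>R (- a *\<^sub>R g y))"
      by (simp only: d_def block_part_scaleR)
    have "(g (y + s *\<^sub>R d) - g y) \<bullet> d
        = (block_part blk i (g (y + s *\<^sub>R d)) - block_part blk i (g y)) \<bullet> d"
      unfolding d_def by (subst inner_block_part) (simp only: block_part_diff)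
    also have "\<dots> \<le> norm (block_part blk i (g (y + s *\<^sub>R d)) - block_part blk i (g y)) * norm d"
      by (rule norm_cauchy_schwarz)
    also have "\<dots> \<le> (M * norm (s *\<^sub>R d)) * norm d"
      unfolding sd by (intro mult_right_mono block_lipschitz assms) auto
    also have "\<dots> = M * s * (norm d)\<^sup>2"
      using s by (simp add: power2_eq_square)
    finally show "(g (y + s *\<^sub>R d) - g y) \<bullet> d \<le> M * s * (norm d)\<^sup>2" .
  qed
  moreover have "g y \<bullet> d = - a * (norm (block_part blk i (g y)))\<^sup>2"
    unfolding d by (simp add: inner_block_part_self)
  moreover have "(norm d)\<^sup>2 = a\<^sup>2 * (norm (block_part blk i (g y)))\<^sup>2"
    unfolding d by (simp add: power_mult_distrib)
  ultimately have "f (y + d) \<le> f y - (a - a\<^sup>2 * M / 2) * (norm (block_part blk i (g y)))\<^sup>2"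
    by (simp add: algebra_simps)
  then show ?thesis
    by (simp only: d scaleR_minus_left add_uminus_conv_diff)
qed

lemma gain_pos: "0 < a - a\<^sup>2 * M / 2"
proof -
  have "a * (a * M) < a * 2"
    using a_pos a_less by (intro mult_strict_left_mono)
  then show ?thesis
    by (simp add: power2_eq_square)
qed

lemma iter_decrease:
  "f (iter s m) \<le> f (fst s) - (a - a\<^sup>2 * M / 2) * used_gradients s m"
proof (induction m)
  case 0
  then show ?case
    by (simp add: iter_0 used_gradients_def)
next
  case (Suc m)
  have "f (iter s (Suc m)) \<le> f (iter s m)
      - (a - a\<^sup>2 * M / 2) * (norm (block_part blk (active s m) (g (iter s m))))\<^sup>2"
    unfolding iter_Suc by (rule block_step_decrease[OF active_range])
  with Suc show ?case
    unfolding used_gradients_Suc distrib_left by linarith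
qed

lemma iter_nonincreasing: "f (iter s m) \<le> f (fst s)"
proof -
  have "0 \<le> (a - a\<^sup>2 * M / 2) * used_gradients s m"
    using gain_pos used_gradients_nonneg by (intro mult_nonneg_nonneg) auto
  with iter_decrease[of s m] show ?thesis
    by linarith
qed

text \<open>
  Within one cycle the displacements belong to different blocks and hence are orthogonal, so their
  squared norms add up without cross terms.
\<close>

lemma cycle_drift:
  assumes "m \<le> P"
  shows "(norm (iter s m - fst s))\<^sup>2 = a\<^sup>2 * used_gradients s m"
proof -
  have fresh: "block_part blk i (iter s n - fst s) = 0" if "i \<notin> active s ` {..<n}" for i n
    using that
  proof (induction n)
    case 0
    then show ?case
      by (simp add: iter_0 block_part_def vec_eq_iff)
  next
    case (Suc n)
    then have "block_part blk i (iter s n - fst s) = 0" "i \<noteq> active s n"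
      by (auto simp: lessThan_Suc)
    then show ?case
      by (simp add: iter_Suc block_part_diff block_part_scaleR block_part_disjoint)
  qed
  show ?thesis
    using assms
  proof (induction m)
    case 0
    then show ?case
      by (simp add: iter_0 used_gradients_def)
  next
    case (Suc m)
    let ?w = "block_part blk (active s m) (g (iter s m))"
    have "active s m \<notin> active s ` {..<m}"
      using Suc.prems inj_onD[OF bij_betw_imp_inj_on[OF active_bij], of s m] by fastforce
    from fresh[OF this] have "(iter s m - fst s) \<bullet> ?w = 0"
      by (subst inner_block_part) simp
    moreover have "(norm (u - a *\<^sub>R w))\<^sup>2 = (norm u)\<^sup>2 + a\<^sup>2 * (norm w)\<^sup>2"
      if "u \<bullet> w = 0" for u w :: "real ^ 'n"
      using that unfolding power2_norm_eq_inner
      by (simp add: inner_diff_left inner_diff_right inner_commute[of w u] power2_eq_square[of a])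
    ultimately have "(norm ((iter s m - fst s) - a *\<^sub>R ?w))\<^sup>2
        = (norm (iter s m - fst s))\<^sup>2 + a\<^sup>2 * (norm ?w)\<^sup>2"
      by blast
    then have "(norm (iter s (Suc m) - fst s))\<^sup>2 = (norm (iter s m - fst s))\<^sup>2 + a\<^sup>2 * (norm ?w)\<^sup>2"
      by (simp add: iter_Suc algebra_simps)
    with Suc show ?case
      by (simp add: used_gradients_Suc distrib_left)
  qed
qed

text \<open>
  Replacing the gradient blocks at the start of the cycle by those that are used during it costs,
  for each of the \<open>P\<close> blocks, the Lipschitz constant times the drift.
\<close>

lemma gradient_le_cycle_gradients:
  "(norm (g (fst s)))\<^sup>2 \<le> 2 * (1 + a\<^sup>2 * L\<^sup>2 * real P) * used_gradients s P"
proof -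
  let ?G = "used_gradients s P"
  have block: "(norm (block_part blk (active s m) (g (fst s))))\<^sup>2
      \<le> 2 * (norm (block_part blk (active s m) (g (iter s m))))\<^sup>2 + 2 * (L\<^sup>2 * (a\<^sup>2 * ?G))"
    if m: "m < P" for m
  proof -
    let ?u = "block_part blk (active s m) (g (iter s m))"
    let ?v = "block_part blk (active s m) (g (fst s))"
    have "norm (?v - ?u) \<le> norm (g (fst s) - g (iter s m))"
      unfolding block_part_diff[symmetric] by (rule norm_block_part_le)
    also have "\<dots> \<le> L * norm (iter s m - fst s)"
      using lipschitz[of "fst s" "iter s m"] by (simp add: norm_minus_commute)
    finally have "(norm (?v - ?u))\<^sup>2 \<le> (L * norm (iter s m - fst s))\<^sup>2"
      by (rule power_mono) simp
    also have "\<dots> = L\<^sup>2 * (a\<^sup>2 * used_gradients s m)"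
      using m by (simp add: power_mult_distrib cycle_drift)
    also have "\<dots> \<le> L\<^sup>2 * (a\<^sup>2 * ?G)"
      using m by (intro mult_left_mono used_gradients_mono) auto
    finally have drift: "(norm (?v - ?u))\<^sup>2 \<le> L\<^sup>2 * (a\<^sup>2 * ?G)" .
    have "norm ?v \<le> norm ?u + norm (?v - ?u)"
      by (rule norm_triangle_sub)
    then have "(norm ?v)\<^sup>2 \<le> (norm ?u + norm (?v - ?u))\<^sup>2"
      by (rule power_mono) simp
    also have "\<dots> \<le> 2 * (norm ?u)\<^sup>2 + 2 * (norm (?v - ?u))\<^sup>2"
      using zero_le_power2[of "norm ?u - norm (?v - ?u)"]
      by (simp add: power2_sum power2_diff)
    finally show ?thesis
      using drift by simp
  qed
  have "(norm (g (fst s)))\<^sup>2 = (\<Sum>m<P. (norm (block_part blk (active s m) (g (fst s))))\<^sup>2)"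
    using norm_sq_eq_sum_blocks[OF part, of "g (fst s)"]
      sum.reindex_bij_betw[OF active_bij, of "\<lambda>i. (norm (block_part blk i (g (fst s))))\<^sup>2" s]
    by simp
  also have "\<dots> \<le> (\<Sum>m<P. 2 * (norm (block_part blk (active s m) (g (iter s m))))\<^sup>2
      + 2 * (L\<^sup>2 * (a\<^sup>2 * ?G)))"
    by (rule sum_mono) (use block in auto)
  also have "\<dots> = 2 * ?G + real P * (2 * (L\<^sup>2 * (a\<^sup>2 * ?G)))"
    by (simp add: sum.distrib sum_distrib_left[symmetric] used_gradients_def)
  also have "\<dots> = 2 * (1 + a\<^sup>2 * L\<^sup>2 * real P) * ?G"
    by (simp add: algebra_simps)
  finally show ?thesis .
qed

definition cycle_gain :: real where
  "cycle_gain = (a - a\<^sup>2 * M / 2) / (2 * (1 + a\<^sup>2 * L\<^sup>2 * real P))"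

lemma denominator_pos: "0 < 2 * (1 + a\<^sup>2 * L\<^sup>2 * real P)"
  by (intro mult_pos_pos add_pos_nonneg) auto

lemma cycle_gain_pos: "0 < cycle_gain"
  unfolding cycle_gain_def by (rule divide_pos_pos[OF gain_pos denominator_pos])

lemma cycle_gain_mult: "cycle_gain * (2 * (1 + a\<^sup>2 * L\<^sup>2 * real P)) = a - a\<^sup>2 * M / 2"
  using cycle_gain_def
  unfolding nonzero_eq_divide_eq[OF less_imp_neq[OF denominator_pos, symmetric]] .

lemma cycle_decrease:
  "f (iter s P) - f z \<le> (1 - 2 * \<mu> * cycle_gain) * (f (fst s) - f z)"
proof -
  have "cycle_gain * (2 * \<mu> * (f (fst s) - f z)) \<le> cycle_gain * (norm (g (fst s)))\<^sup>2"
    using cycle_gain_pos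
    by (intro mult_left_mono gap_le_gradient[OF mu_pos strongly_convex]) auto
  also have "\<dots> \<le> cycle_gain * (2 * (1 + a\<^sup>2 * L\<^sup>2 * real P) * used_gradients s P)"
    using cycle_gain_pos by (intro mult_left_mono gradient_le_cycle_gradients) auto
  also have "\<dots> = (a - a\<^sup>2 * M / 2) * used_gradients s P"
    unfolding cycle_gain_mult[symmetric] by (rule mult.assoc[symmetric])
  finally show ?thesis
    using iter_decrease[of s P] by (simp add: algebra_simps)
qed

lemma strong_convexity_le_lipschitz: "\<mu> \<le> L"
proof -
  let ?e = "1 :: real ^ 'n"
  have e: "0 < (norm ?e)\<^sup>2"
    by simp
  have "\<mu> * (norm ?e)\<^sup>2 \<le> (g ?e - g 0) \<bullet> ?e"
    using strongly_convex[of 0 ?e] strongly_convex[of ?e 0] by (simp add: inner_diff_left)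
  also have "\<dots> \<le> norm (g ?e - g 0) * norm ?e"
    by (rule norm_cauchy_schwarz)
  also have "\<dots> \<le> L * norm (?e - 0) * norm ?e"
    by (intro mult_right_mono lipschitz) auto
  finally have "\<mu> * (norm ?e)\<^sup>2 \<le> L * (norm ?e)\<^sup>2"
    by (simp add: power2_eq_square)
  with e show ?thesis
    by (simp del: zero_less_power2 add: mult_le_cancel_right)
qed

text \<open>
  The rate has to be positive for its real powers to be meaningful.  By \<open>2 a L \<le> 1 + a\<^sup>2 L\<^sup>2\<close> the
  gain is at most \<open>1 / (4 L)\<close>, so the rate is even at least \<open>1 / 2\<close>.
\<close>

lemma cycle_rate_bounds: "0 < 1 - 2 * \<mu> * cycle_gain" "1 - 2 * \<mu> * cycle_gain \<le> 1"
proof -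
  let ?D = "2 * (1 + a\<^sup>2 * L\<^sup>2 * real P)"
  have "2 * (L * a) \<le> 1 + a\<^sup>2 * L\<^sup>2"
    using zero_le_power2[of "a * L - 1"] by (simp add: power2_diff power_mult_distrib mult.commute)
  moreover have "a\<^sup>2 * L\<^sup>2 \<le> a\<^sup>2 * L\<^sup>2 * real P"
    using P_pos mult_left_mono[of 1 "real P" "a\<^sup>2 * L\<^sup>2"] by simp
  ultimately have "2 * (L * a) \<le> 1 + a\<^sup>2 * L\<^sup>2 * real P"
    by linarith
  then have D: "2 * (L * a) < ?D"
    using denominator_pos by simp
  have "2 * \<mu> * cycle_gain * ?D = 2 * (\<mu> * (a - a\<^sup>2 * M / 2))"
    unfolding cycle_gain_mult[symmetric] by (simp only: mult.assoc)
  also have "\<mu> * (a - a\<^sup>2 * M / 2) \<le> L * a"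
    using strong_convexity_le_lipschitz mu_pos gain_pos M_pos by (intro mult_mono) auto
  finally have "2 * \<mu> * cycle_gain * ?D < 1 * ?D"
    using D by linarith
  then have "2 * \<mu> * cycle_gain < 1"
    using denominator_pos by (simp only: mult_less_cancel_right_pos)
  then show "0 < 1 - 2 * \<mu> * cycle_gain"
    by simp
  show "1 - 2 * \<mu> * cycle_gain \<le> 1"
    using mu_pos cycle_gain_pos by simp
qed

lemma cycles_decrease:
  "f (iter s (q * P)) - f z \<le> (1 - 2 * \<mu> * cycle_gain) ^ q * (f (fst s) - f z)"
proof (induction q)
  case 0
  then show ?case
    by (simp add: iter_0)
next
  case (Suc q)
  let ?r = "1 - 2 * \<mu> * cycle_gain"
  have "f (iter s (Suc q * P)) - f z \<le> ?r * (f (iter s (q * P)) - f z)"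
    using cycle_decrease[of "(block_update P blk a g ^^ (q * P)) s" z]
    by (simp add: iter_add) (simp add: iter_def)
  also have "\<dots> \<le> ?r * (?r ^ q * (f (fst s) - f z))"
    using cycle_rate_bounds by (intro mult_left_mono Suc) auto
  finally show ?case
    by (simp add: mult.assoc)
qed

lemma smooth_upper_bound: "f z \<le> f y + g y \<bullet> (z - y) + L / 2 * (norm (z - y))\<^sup>2"
proof -
  have "f (y + (z - y)) \<le> f y + g y \<bullet> (z - y) + L / 2 * (norm (z - y))\<^sup>2"
  proof (rule descent_inequality[OF grad])
    fix s :: real assume s: "0 \<le> s"
    have "(g (y + s *\<^sub>R (z - y)) - g y) \<bullet> (z - y) \<le> norm (g (y + s *\<^sub>R (z - y)) - g y) * norm (z - y)"
      by (rule norm_cauchy_schwarz)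
    also have "\<dots> \<le> L * norm (y + s *\<^sub>R (z - y) - y) * norm (z - y)"
      by (intro mult_right_mono lipschitz) auto
    also have "\<dots> = L * s * (norm (z - y))\<^sup>2"
      using s by (simp add: power2_eq_square)
    finally show "(g (y + s *\<^sub>R (z - y)) - g y) \<bullet> (z - y) \<le> L * s * (norm (z - y))\<^sup>2" .
  qed
  then show ?thesis
    by simp
qed

text \<open>
  Function values are converted to distances at both ends, by strong convexity after the updates
  and by smoothness before them.  The incomplete cycle is estimated by monotonicity and
  placed at the end, after \<open>k div P\<close> full ones.
\<close>

lemma contraction:
  assumes "g z = 0"
  shows "(norm (iter s k - z))\<^sup>2
    \<le> L / \<mu> * (1 - 2 * \<mu> * cycle_gain) powr ((real k + 1 - real P) / real P) * (norm (fst s - z))\<^sup>2"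
proof -
  let ?r = "1 - 2 * \<mu> * cycle_gain"
  let ?q = "k div P"
  have "k mod P \<le> P - 1"
    using P_pos mod_less_divisor[of P k] by linarith
  then have "k + 1 \<le> ?q * P + P"
    using P_pos div_mult_mod_eq[of k P] by linarith
  then have "real k + 1 \<le> real ?q * real P + real P"
    by (metis of_nat_1 of_nat_add of_nat_le_iff of_nat_mult)
  then have q: "(real k + 1 - real P) / real P \<le> real ?q"
    using P_pos by (simp add: divide_le_eq)
  have "?r ^ ?q = ?r powr real ?q"
    using cycle_rate_bounds by (simp add: powr_realpow)
  also have "\<dots> \<le> ?r powr ((real k + 1 - real P) / real P)"
    using q cycle_rate_bounds by (intro powr_mono') auto
  finally have rate: "?r ^ ?q \<le> ?r powr ((real k + 1 - real P) / real P)" .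
  have "0 \<le> \<mu> / 2 * (norm (fst s - z))\<^sup>2"
    using mu_pos by simp
  then have gap: "0 \<le> f (fst s) - f z" "f (fst s) - f z \<le> L / 2 * (norm (fst s - z))\<^sup>2"
    using strongly_convex[of z "fst s"] smooth_upper_bound[of "fst s" z]
    unfolding assms inner_zero_left by linarith+
  have "f (iter s k) \<le> f (iter s (?q * P))"
    using iter_nonincreasing[of "(block_update P blk a g ^^ (?q * P)) s" "k mod P"]
    by (simp add: iter_def[symmetric] iter_add[symmetric])
  have "\<mu> / 2 * (norm (iter s k - z))\<^sup>2 \<le> f (iter s k) - f z"
    using strongly_convex[of z "iter s k"] assms by simp
  also have "\<dots> \<le> f (iter s (?q * P)) - f z"
    using \<open>f (iter s k) \<le> f (iter s (?q * P))\<close> by simp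
  also have "\<dots> \<le> ?r ^ ?q * (f (fst s) - f z)"
    by (rule cycles_decrease)
  also have "\<dots> \<le> ?r powr ((real k + 1 - real P) / real P) * (L / 2 * (norm (fst s - z))\<^sup>2)"
    using rate gap by (intro mult_mono) auto
  finally show ?thesis
    using mu_pos by (simp add: field_simps)
qed

end

section \<open>Tracking moving minimizers\<close>

text \<open>
  The recursion bounds the errors from time \<open>2\<close> on, in terms of the steps of \<open>z\<close> from time \<open>1\<close>
  on.  The correction term supplies the error at time \<open>1\<close> and removes the step from time \<open>0\<close> to
  time \<open>1\<close>, which \<open>squared_path_length\<close> contains.
\<close>

lemma tracking_error_sum:
  fixes x z :: "nat \<Rightarrow> 'a::real_normed_vector"
  assumes contr: "\<And>t. (norm (x (Suc t) - z t))\<^sup>2 \<le> B * (norm (x t - z t))\<^sup>2"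
    and "T \<ge> 1" and "0 \<le> B"
  shows "(1 - 2 * B) * (\<Sum>t = 1..T. (norm (x t - z t))\<^sup>2)
    \<le> 2 * squared_path_length z T + ((norm (x 1 - z 1))\<^sup>2 - 2 * (norm (z 1 - z 0))\<^sup>2)"
proof -
  have recursion: "(norm (x (Suc t) - z (Suc t)))\<^sup>2
      \<le> 2 * B * (norm (x t - z t))\<^sup>2 + 2 * (norm (z (Suc t) - z t))\<^sup>2" for t
  proof -
    have "norm (x (Suc t) - z (Suc t)) \<le> norm (x (Suc t) - z t) + norm (z (Suc t) - z t)"
      using norm_triangle_ineq4[of "x (Suc t) - z t" "z (Suc t) - z t"] by simp
    then have "(norm (x (Suc t) - z (Suc t)))\<^sup>2 \<le> (norm (x (Suc t) - z t) + norm (z (Suc t) - z t))\<^sup>2"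
      by (rule power_mono) simp
    also have "\<dots> \<le> 2 * (norm (x (Suc t) - z t))\<^sup>2 + 2 * (norm (z (Suc t) - z t))\<^sup>2"
      using zero_le_power2[of "norm (x (Suc t) - z t) - norm (z (Suc t) - z t)"]
      by (simp add: power2_sum power2_diff)
    finally show ?thesis
      using contr[of t] by simp
  qed
  \<comment> \<open>The errors at the times \<open>2, \<dots>, T\<close> are bounded through those at \<open>1, \<dots>, T - 1\<close>, so the term
      \<open>2 B |x T - z T|\<^sup>2\<close> remains on the left, and the next step of the induction consumes it.\<close>
  have "(1 - 2 * B) * (\<Sum>t = 1..T. (norm (x t - z t))\<^sup>2) + 2 * B * (norm (x T - z T))\<^sup>2
    \<le> 2 * squared_path_length z T + ((norm (x 1 - z 1))\<^sup>2 - 2 * (norm (z 1 - z 0))\<^sup>2)"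
    using \<open>T \<ge> 1\<close>
  proof (induction T rule: dec_induct)
    case base
    then show ?case
      by (simp add: squared_path_length_def algebra_simps)
  next
    case (step n)
    then show ?case
      using recursion[of n]
      by (simp add: squared_path_length_def algebra_simps)
  qed
  moreover have "0 \<le> 2 * B * (norm (x T - z T))\<^sup>2"
    using \<open>0 \<le> B\<close> by simp
  ultimately show ?thesis
    by linarith
qed

theorem theorem6:
  fixes f :: "nat \<Rightarrow> real ^ 'n \<Rightarrow> real"
    and gradf :: "nat \<Rightarrow> real ^ 'n \<Rightarrow> real ^ 'n"
    and \<Theta> :: "(real ^ 'n) set"
    and blk :: "'n \<Rightarrow> nat"
    and Lb :: "nat \<Rightarrow> real"
    and xstar x :: "nat \<Rightarrow> real ^ 'n"
    and x0 :: "real ^ 'n"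
    and P k i0 T :: nat
    and \<mu> L Lmax \<alpha> A B5 C2 :: real
  assumes "\<And>t. convex_on UNIV (f t)"
    and "\<And>t y. GDERIV (f t) y :> gradf t y"
    and "\<And>t. continuous_on UNIV (gradf t)"
    and "\<Theta> \<noteq> {}" and "closed \<Theta>" and "convex \<Theta>"
    and "block_partition P blk"
    and "\<And>t. is_arg_min (f t) (\<lambda>y. y \<in> \<Theta>) (xstar t)"
    and "\<And>t. gradf t (xstar t) = 0"
    and "\<mu> > 0" and "L > 0" and "\<And>i. i \<in> {1..P} \<Longrightarrow> Lb i > 0"
    and "\<And>t y z. f t z \<ge> f t y + gradf t y \<bullet> (z - y) + \<mu> / 2 * (norm (z - y))\<^sup>2"
    and "\<And>t y z. norm (gradf t y - gradf t z) \<le> L * norm (y - z)"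
    and "\<And>t y i u. i \<in> {1..P} \<Longrightarrow>
           norm (block_part blk i (gradf t (y + block_part blk i u)) - block_part blk i (gradf t y))
             \<le> Lb i * norm (block_part blk i u)"
    and "Lmax = Max (Lb ` {1..P})"
    and "0 < \<alpha>" and "\<alpha> < 2 / Lmax"
    and "A = (\<alpha> - \<alpha>\<^sup>2 * Lmax / 2) / (2 * (1 + \<alpha>\<^sup>2 * L\<^sup>2 * real P))"
    and "k \<ge> 1"
    and "B5 = L / \<mu> * (1 - 2 * \<mu> * A) powr ((real k + 1 - real P) / real P)
                * (1 + \<alpha> * Lmax) ^ (2 * P - 2)"
    and "B5 < 1 / 2"
    and "x0 \<in> \<Theta>" and "i0 \<in> {1..P}"
    and "x = cyclic_cd P blk \<Theta> k (\<lambda>t. \<alpha>) gradf x0 i0"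
    and "C2 = (norm (x 1 - xstar 1))\<^sup>2 - 2 * (norm (xstar 1 - xstar 0))\<^sup>2"
    and "T \<ge> 1"
  shows "dynamic_regret f x xstar T
           \<le> L / (2 - 4 * B5) * (2 * squared_path_length xstar T + C2)"
proof -
  note convex_set = assms(4-6) and star = assms(8) and grad0 = assms(9)
  note mu = assms(10) and L = assms(11) and B5 = assms(21,22)
  have "P > 0"
    using assms(7) by (rule block_partition_pos)
  then have Lb_le: "Lb i \<le> Lmax" if "i \<in> {1..P}" for i
    using that assms(16) by simp
  have "0 < Lmax"
    using Lb_le[of 1] assms(12)[of 1] \<open>P > 0\<close> by simp
  have block_lip: "norm (block_part blk i (gradf t (y + block_part blk i u)) - block_part blk i (gradf t y))
      \<le> Lmax * norm (block_part blk i u)" if "i \<in> {1..P}" for t y i u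
    by (rule order_trans[OF assms(15)[OF that] mult_right_mono[OF Lb_le[OF that] norm_ge_zero]])
  interpret F: cyclic_descent "f t" "gradf t" blk P \<mu> L Lmax \<alpha> for t
    using assms(2,7,13,14,17,18) mu L \<open>0 < Lmax\<close> block_lip
    by unfold_locales (auto simp: less_divide_eq)
  have A: "F.cycle_gain = A"
    unfolding F.cycle_gain_def assms(19) ..
  let ?\<rho> = "L / \<mu> * (1 - 2 * \<mu> * A) powr ((real k + 1 - real P) / real P)"
  have \<rho>_nonneg: "0 \<le> ?\<rho>"
    using mu L by simp
  have "1 \<le> (1 + \<alpha> * Lmax) ^ (2 * P - 2)"
    using assms(17) \<open>0 < Lmax\<close> by (intro one_le_power) simp
  then have \<rho>_le: "?\<rho> \<le> B5"
    unfolding B5(1) using \<rho>_nonneg mult_left_mono by fastforce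
  have contr: "(norm (x (Suc t) - xstar t))\<^sup>2 \<le> B5 * (norm (x t - xstar t))\<^sup>2" for t
  proof -
    define s where "s = cyclic_cd_state P blk \<Theta> k (\<lambda>t. \<alpha>) gradf x0 i0 t"
    have xt: "x t = fst s" and xSuc: "x (Suc t) = closest_point \<Theta> (F.iter t s k)"
      by (simp_all add: assms(25) cyclic_cd_def s_def F.iter_def Let_def)
    have "xstar t \<in> \<Theta>"
      using star[of t] by (simp add: is_arg_min_def)
    then have "closest_point \<Theta> (xstar t) = xstar t"
      by (rule closest_point_self)
    then have "norm (x (Suc t) - xstar t) \<le> norm (F.iter t s k - xstar t)"
      using closest_point_lipschitz[OF convex_set(3,2,1), of "F.iter t s k" "xstar t"]
      by (simp add: xSuc dist_norm)
    then have "(norm (x (Suc t) - xstar t))\<^sup>2 \<le> (norm (F.iter t s k - xstar t))\<^sup>2"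
      by (rule power_mono) simp
    also have "\<dots> \<le> ?\<rho> * (norm (x t - xstar t))\<^sup>2"
      using F.contraction[OF grad0, where s = s and k = k] by (simp only: xt A)
    also have "\<dots> \<le> B5 * (norm (x t - xstar t))\<^sup>2"
      using \<rho>_le by (rule mult_right_mono) simp
    finally show ?thesis .
  qed
  let ?E = "\<Sum>t = 1..T. (norm (x t - xstar t))\<^sup>2"
  have "f t (x t) - f t (xstar t) \<le> L / 2 * (norm (x t - xstar t))\<^sup>2" for t
    using F.smooth_upper_bound[of t "x t" "xstar t"] by (simp add: grad0)
  then have "dynamic_regret f x xstar T \<le> L / 2 * ?E"
    unfolding dynamic_regret_def sum_subtractf[symmetric] sum_distrib_left
    by (intro sum_mono)
  also have "\<dots> = L / (2 - 4 * B5) * ((1 - 2 * B5) * ?E)"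
    using B5(2) by (simp add: field_simps)
  also have "\<dots> \<le> L / (2 - 4 * B5) * (2 * squared_path_length xstar T + C2)"
    unfolding assms(26)
    using tracking_error_sum[of x xstar B5, OF contr assms(27)] \<rho>_nonneg \<rho>_le L B5(2)
    by (intro mult_left_mono) auto
  finally show ?thesis .
qed

end
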